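(* Let $x_0\in\mathbb{R}^{n_1}$, $y_0\in\mathbb{R}^{n_2}$, $X\in\mathbb{R}^{m\times n_1}$, $Y\in\mathbb{R}^{m\times n_2}$ be entrywise nonnegative, and let $\delta^*$ be the robustness coefficient of $\mathrm{DMU}_0$ defined in the context. Then $$\delta^*=\max\Big\{\delta\in\mathbb{R} : \exists\, u\in\mathbb{R}^{n_2},\ v\in\mathbb{R}^{n_1},\ u,v\ge 0,\ (1-\delta)y_0^Tu\ge 1,\ (1+\delta)x_0^Tv\le 1,\ (1+\delta)Yu-(1-\delta)Xv\le 0\Big\},$$ where the maximum is understood as a supremum if it is not attained.
   Context: The data $(x_0,y_0,X,Y)$ consist of the input vector $x_0$ and output vector $y_0$ of the decision making unit $\mathrm{DMU}_0$, and the matrices $X$, $Y$ whose $i$th rows are the input and output vectors of the $i$th of the $m$ other decision making units. Vector inequalities are entrywise. Efficiency: for data $(x_0,y_0,X,Y)$, $\mathrm{DMU}_0$ is called efficient if the optimal value of the linear program $\max\ y_0^Tu$ subject to $x_0^Tv\le 1$, $Yu-Xv\le 0$, $u,v\ge 0$ is at least $1$; equivalently, if the system $y_0^Tu\ge 1$, $x_0^Tv\le 1$, $Yu-Xv\le 0$, $u,v\ge 0$ is feasible. Otherwise it is inefficient. The same definition applies to perturbed data. Neighborhood: write $x_{0j}$, $y_{0k}$ for the entries of $x_0,y_0$ and $x_{ij}$, $y_{ik}$ ($i=1,\dots,m$) for the entries of $X,Y$. For $\delta\in\mathbb{R}$ let $$\mathcal{O}_\delta(x_0,y_0,X,Y)=\{(x_0',y_0',X',Y')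 : |x'_{ij}-x_{ij}|\le\delta x_{ij},\ |y'_{ik}-y_{ik}|\le\delta y_{ik}\ \ \forall i=0,1,\dots,m,\ \forall j,k\}.$$ Robustness coefficient: if $\mathrm{DMU}_0$ is efficient (for the data $(x_0,y_0,X,Y)$), then $\delta^*$ is the maximum of all $\delta$ such that $\mathrm{DMU}_0$ is efficient for all data in $\mathcal{O}_\delta(x_0,y_0,X,Y)$. If $\mathrm{DMU}_0$ is inefficient, then $\delta^*=-\min\delta$, the minimum being over all $\delta$ such that $\mathrm{DMU}_0$ is efficient for some data in $\mathcal{O}_\delta(x_0,y_0,X,Y)$. Whenever a maximum or minimum is not attained it is replaced by the supremum or infimum, with the conventions $\sup\emptyset=-\infty$, $\inf\emptyset=+\infty$. *)

theory Defs
  imports "HOL-Analysis.Analysis"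
begin

text \<open>Inequalities between vectors are the library's componentwise order on \<^type>\<open>vec\<close>;
  on matrices (vectors of rows) this is the entrywise order.\<close>

definition dea_feasible ::
  "real^'n1 \<Rightarrow> real^'n1^'m \<Rightarrow> real^'n2^'m \<Rightarrow> ((real^'n2) \<times> (real^'n1)) set"
  where "dea_feasible x0 X Y =
    {(u, v). x0 \<bullet> v \<le> 1 \<and> Y *v u - X *v v \<le> 0 \<and> 0 \<le> u \<and> 0 \<le> v}"

text \<open>The optimal value is taken in the extended reals: the program is always feasible
  (take \<open>u = v = 0\<close>), but it may be unbounded, with optimal value \<open>\<infinity>\<close>.\<close>

definition dea_value ::
  "real^'n1 \<Rightarrow> real^'n2 \<Rightarrow> real^'n1^'m \<Rightarrow> real^'n2^'m \<Rightarrow> ereal"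
  where "dea_value x0 y0 X Y = (SUP (u, v)\<in>dea_feasible x0 X Y. ereal (y0 \<bullet> u))"

definition efficient ::
  "real^'n1 \<Rightarrow> real^'n2 \<Rightarrow> real^'n1^'m \<Rightarrow> real^'n2^'m \<Rightarrow> bool"
  where "efficient x0 y0 X Y \<longleftrightarrow> dea_value x0 y0 X Y \<ge> 1"

lemma closed_linear_image_orthant:
  fixes T :: "'a::euclidean_space \<Rightarrow> 'b::euclidean_space"
  assumes "linear T"
  shows "closed (T ` {x. \<forall>b\<in>Basis. 0 \<le> x \<bullet> b})"
proof -
  have "x \<in> convex_cone hull Basis" if "\<forall>b\<in>Basis. 0 \<le> x \<bullet> b" for x :: 'a
  proof -
    have "(\<Sum>b\<in>F. (x \<bullet> b) *\<^sub>R b) \<in> convex_cone hull Basis" if "finite F" "F \<subseteq> Basis" for F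
      using that
    proof (induction F)
      case empty
      then show ?case by (simp add: convex_cone_hull_contains_0)
    next
      case (insert b F)
      then show ?case
        using \<open>\<forall>b\<in>Basis. 0 \<le> x \<bullet> b\<close>
        by (simp add: convex_cone_add convex_cone_scaleR convex_cone_convex_cone_hull hull_inc)
    qed
    from this[of Basis] show ?thesis by (simp add: euclidean_representation)
  qed
  moreover have "convex_cone hull Basis \<subseteq> {x::'a. \<forall>b\<in>Basis. 0 \<le> x \<bullet> b}"
    by (rule hull_minimal)
      (auto simp: inner_Basis convex_cone_def convex_def conic_def inner_simps intro!: exI[of _ 0])
  ultimately have "{x::'a. \<forall>b\<in>Basis. 0 \<le> x \<bullet> b} = convex_cone hull Basis"
    by blast
  then have "T ` {x. \<forall>b\<in>Basis. 0 \<le> x \<bullet> b} = convex_cone hull (T ` Basis)"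
    using convex_cone_hull_linear_image[OF assms] by metis
  then show ?thesis
    by (simp add: closed_convex_cone_hull)
qed

lemma efficient_iff_feasible:
  fixes x0 :: "real^'n1" and y0 :: "real^'n2" and X :: "real^'n1^'m" and Y :: "real^'n2^'m"
  shows "efficient x0 y0 X Y \<longleftrightarrow>
    (\<exists>u v. y0 \<bullet> u \<ge> 1 \<and> x0 \<bullet> v \<le> 1 \<and> Y *v u - X *v v \<le> 0 \<and> 0 \<le> u \<and> 0 \<le> v)"
    (is "_ \<longleftrightarrow> ?R")
proof
  assume e: "efficient x0 y0 X Y"
  define T :: "(real^'n2) \<times> (real^'n1) \<times> real \<times> real \<times> (real^'m) \<Rightarrow> real \<times> real \<times> (real^'m)"
    where "T = (\<lambda>(u, v, p, q, s). (y0 \<bullet> u - p, x0 \<bullet> v + q, Y *v u - X *v v + s))"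
  define P :: "((real^'n2) \<times> (real^'n1) \<times> real \<times> real \<times> (real^'m)) set"
    where "P = {x. \<forall>b\<in>Basis. 0 \<le> x \<bullet> b}"
  have mem: "(u, v, p, q, s) \<in> P \<longleftrightarrow> 0 \<le> u \<and> 0 \<le> v \<and> 0 \<le> p \<and> 0 \<le> q \<and> 0 \<le> s" for u v p q s
    by (auto simp: P_def Basis_prod_def Basis_vec_def ball_Un less_eq_vec_def inner_axis)
  have "linear T"
    unfolding T_def
    by (rule linearI)
      (auto simp: inner_simps matrix_vector_right_distrib matrix_vector_mult_scaleR algebra_simps)
  then have "closed (T ` P)"
    unfolding P_def by (rule closed_linear_image_orthant)
  moreover have "(1 - inverse (real (Suc n)), 1, 0) \<in> T ` P" for n
  proof -
    have "ereal (1 - inverse (real (Suc n))) < dea_value x0 y0 X Y"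
      using e unfolding efficient_def
      by (rule less_le_trans[rotated]) (simp add: one_ereal_def)
    then obtain u v where uv: "(u, v) \<in> dea_feasible x0 X Y"
      and "1 - inverse (real (Suc n)) < y0 \<bullet> u"
      by (auto simp: dea_value_def less_SUP_iff)
    then have "(u, v, y0 \<bullet> u - (1 - inverse (real (Suc n))), 1 - x0 \<bullet> v, - (Y *v u - X *v v)) \<in> P"
      by (auto simp: mem dea_feasible_def less_eq_vec_def)
    then show ?thesis
      by (rule rev_image_eqI) (simp add: T_def)
  qed
  moreover have "(\<lambda>n. (1 - inverse (real (Suc n)), 1::real, 0::real^'m)) \<longlonglongrightarrow> (1 - 0, 1, 0)"
    by (intro tendsto_intros LIMSEQ_inverse_real_of_nat)
  ultimately have "(1 - 0, 1, 0) \<in> T ` P"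
    by (rule closed_sequentially)
  then obtain u v p q s where "(u, v, p, q, s) \<in> P" and "T (u, v, p, q, s) = (1, 1, 0)"
    by (metis (no_types, lifting) diff_zero imageE prod_cases5)
  then have "1 = y0 \<bullet> u - p" "1 = x0 \<bullet> v + q" "Y *v u - X *v v = - s"
    and "0 \<le> u" "0 \<le> v" "0 \<le> p" "0 \<le> q" "0 \<le> s"
    by (auto simp: T_def mem eq_neg_iff_add_eq_0)
  then show ?R
    by (intro exI[of _ u] exI[of _ v]) (auto simp: less_eq_vec_def)
next
  assume ?R
  then obtain u v where "1 \<le> y0 \<bullet> u" and "(u, v) \<in> dea_feasible x0 X Y"
    by (auto simp: dea_feasible_def)
  then show "efficient x0 y0 X Y"
    unfolding efficient_def dea_value_def
    by (intro SUP_upper2[of "(u, v)"]) (auto simp: one_ereal_def)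
qed

definition neighborhood ::
  "real \<Rightarrow> real^'n1 \<Rightarrow> real^'n2 \<Rightarrow> real^'n1^'m \<Rightarrow> real^'n2^'m \<Rightarrow>
    ((real^'n1) \<times> (real^'n2) \<times> (real^'n1^'m) \<times> (real^'n2^'m)) set"
  where "neighborhood \<delta> x0 y0 X Y = {(x0', y0', X', Y').
    (\<forall>j. \<bar>x0' $ j - x0 $ j\<bar> \<le> \<delta> * x0 $ j) \<and>
    (\<forall>k. \<bar>y0' $ k - y0 $ k\<bar> \<le> \<delta> * y0 $ k) \<and>
    (\<forall>i j. \<bar>X' $ i $ j - X $ i $ j\<bar> \<le> \<delta> * X $ i $ j) \<and>
    (\<forall>i k. \<bar>Y' $ i $ k - Y $ i $ k\<bar> \<le> \<delta> * Y $ i $ k)}"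

text \<open>All real \<open>\<delta>\<close> are admitted, including negative ones. Suprema and infima are taken in
  the extended reals, where \<open>Sup {} = - \<infinity>\<close> and \<open>Inf {} = \<infinity>\<close>.\<close>

definition robustness ::
  "real^'n1 \<Rightarrow> real^'n2 \<Rightarrow> real^'n1^'m \<Rightarrow> real^'n2^'m \<Rightarrow> ereal"
  where "robustness x0 y0 X Y =
    (if efficient x0 y0 X Y
     then Sup (ereal ` {\<delta>. \<forall>(x0', y0', X', Y') \<in> neighborhood \<delta> x0 y0 X Y. efficient x0' y0' X' Y'})
     else - Inf (ereal ` {\<delta>. \<exists>(x0', y0', X', Y') \<in> neighborhood \<delta> x0 y0 X Y. efficient x0' y0' X' Y'}))"

end

theory Submission
  imports Defs
begin

text \<open>
  The efficiency of \<open>DMU\<^sub>0\<close> is helped by smaller \<open>x0\<close> and \<open>Y\<close> and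
  by larger \<open>y0\<close> and \<open>X\<close>, because a weight pair \<open>u, v \<ge> 0\<close> that certifies efficiency goes on
  certifying it after such a change (lemma \<open>efficient_mono\<close>). Hence, for \<open>\<delta> \<ge> 0\<close>, the neighborhood
  of radius \<open>\<delta>\<close> has a least and a most favorable member. Both lie on the one-parameter family
  \<open>((1 + s) x0, (1 - s) y0, (1 - s) X, (1 + s) Y)\<close>, at \<open>s = \<delta>\<close> and at \<open>s = - \<delta>\<close> respectively. So
  efficiency throughout the neighborhood is efficiency at \<open>s = \<delta>\<close>, and efficiency somewhere in it is
  efficiency at \<open>s = - \<delta>\<close>.

  The parameters \<open>s\<close> at which the family is efficient form the set in the theorem, by the
  feasibility form of efficiency. That set is closed downwards, because in nonnegative data raising
  \<open>s\<close> raises \<open>x0\<close> and \<open>Y\<close> and lowers \<open>y0\<close> and \<open>X\<close>; and \<open>s = 0\<close> is the given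
  data. If the given data are efficient, every \<open>\<delta> \<le> 0\<close> therefore belongs to this set; it also belongs
  to the set that defines the robustness coefficient, since a neighborhood of nonpositive radius contains at
  most the data themselves. The two sets thus coincide. If the given data are inefficient, the same
  reasoning makes them mirror images under \<open>\<delta> \<mapsto> - \<delta>\<close>. Since the sets themselves are compared,
  suprema that are not attained need no separate argument.
\<close>

lemma inner_mono_vec:
  fixes a b w :: "real^'n"
  assumes "a \<le> b" and "0 \<le> w"
  shows "a \<bullet> w \<le> b \<bullet> w"
  using assms by (auto simp: inner_vec_def less_eq_vec_def intro!: sum_mono mult_right_mono)

lemma matrix_vector_mult_mono:
  fixes A B :: "real^'n^'m" and w :: "real^'n"
  assumes "A \<le> B" and "0 \<le> w"
  shows "A *v w \<le> B *v w"
  using assms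
  by (auto simp: matrix_vector_mult_def less_eq_vec_def intro!: sum_mono mult_right_mono)

lemma efficient_mono:
  fixes x0 x0' :: "real^'n1" and y0 y0' :: "real^'n2"
    and X X' :: "real^'n1^'m" and Y Y' :: "real^'n2^'m"
  assumes "efficient x0 y0 X Y" and "x0' \<le> x0" and "y0 \<le> y0'" and "X \<le> X'" and "Y' \<le> Y"
  shows "efficient x0' y0' X' Y'"
proof -
  obtain u v where uv: "1 \<le> y0 \<bullet> u" "x0 \<bullet> v \<le> 1" "Y *v u - X *v v \<le> 0" "0 \<le> u" "0 \<le> v"
    using assms(1) by (auto simp: efficient_iff_feasible)
  have "y0 \<bullet> u \<le> y0' \<bullet> u" "x0' \<bullet> v \<le> x0 \<bullet> v"
    using assms uv by (auto intro: inner_mono_vec)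
  moreover have "Y' *v u \<le> Y *v u" "X *v v \<le> X' *v v"
    using assms uv by (auto intro: matrix_vector_mult_mono)
  then have "Y' *v u - X' *v v \<le> 0"
    using uv(3) by (fastforce simp: less_eq_vec_def intro: order_trans)
  ultimately show ?thesis
    unfolding efficient_iff_feasible using uv by (intro exI[of _ u] exI[of _ v]) auto
qed

text \<open>The parameter \<open>s\<close> measures how far the data are tilted against \<open>DMU\<^sub>0\<close>; a negative \<open>s\<close>
  tilts them in its favor.\<close>

definition efficient_tilted ::
  "real \<Rightarrow> real^'n1 \<Rightarrow> real^'n2 \<Rightarrow> real^'n1^'m \<Rightarrow> real^'n2^'m \<Rightarrow> bool"
  where "efficient_tilted s x0 y0 X Y \<longleftrightarrow>
    efficient ((1 + s) *\<^sub>R x0) ((1 - s) *\<^sub>R y0) ((1 - s) *\<^sub>R X) ((1 + s) *\<^sub>R Y)"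

lemma efficient_tilted_0: "efficient_tilted 0 x0 y0 X Y \<longleftrightarrow> efficient x0 y0 X Y"
  by (simp add: efficient_tilted_def)

lemma efficient_tilted_iff_feasible:
  fixes x0 :: "real^'n1" and y0 :: "real^'n2" and X :: "real^'n1^'m" and Y :: "real^'n2^'m"
  shows "efficient_tilted s x0 y0 X Y \<longleftrightarrow>
    (\<exists>(u::real^'n2) (v::real^'n1). 0 \<le> u \<and> 0 \<le> v \<and>
      (1 - s) * (y0 \<bullet> u) \<ge> 1 \<and> (1 + s) * (x0 \<bullet> v) \<le> 1 \<and>
      (1 + s) *\<^sub>R (Y *v u) - (1 - s) *\<^sub>R (X *v v) \<le> 0)"
  unfolding efficient_tilted_def efficient_iff_feasible scaleR_matrix_vector_assoc[symmetric]
    inner_scaleR_left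
  by blast

lemma neighborhood_bounds:
  fixes x0 x0' :: "real^'n1" and y0 y0' :: "real^'n2"
    and X X' :: "real^'n1^'m" and Y Y' :: "real^'n2^'m"
  assumes "(x0', y0', X', Y') \<in> neighborhood \<delta> x0 y0 X Y"
  shows "(1 - \<delta>) *\<^sub>R x0 \<le> x0'" "x0' \<le> (1 + \<delta>) *\<^sub>R x0"
    "(1 - \<delta>) *\<^sub>R y0 \<le> y0'" "y0' \<le> (1 + \<delta>) *\<^sub>R y0"
    "(1 - \<delta>) *\<^sub>R X \<le> X'" "X' \<le> (1 + \<delta>) *\<^sub>R X"
    "(1 - \<delta>) *\<^sub>R Y \<le> Y'" "Y' \<le> (1 + \<delta>) *\<^sub>R Y"
  using assms
  by (auto simp: neighborhood_def less_eq_vec_def abs_le_iff algebra_simps)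

context
  fixes x0 :: "real^'n1" and y0 :: "real^'n2" and X :: "real^'n1^'m" and Y :: "real^'n2^'m"
  assumes nonneg: "0 \<le> x0" "0 \<le> y0" "0 \<le> X" "0 \<le> Y"
begin

lemma efficient_tilted_antimono:
  assumes "efficient_tilted t x0 y0 X Y" and "s \<le> t"
  shows "efficient_tilted s x0 y0 X Y"
  using assms nonneg unfolding efficient_tilted_def
  by (elim efficient_mono) (auto simp: less_eq_vec_def intro!: mult_right_mono)

lemma tilted_in_neighborhood:
  assumes "\<bar>s\<bar> \<le> \<delta>"
  shows "((1 + s) *\<^sub>R x0, (1 - s) *\<^sub>R y0, (1 - s) *\<^sub>R X, (1 + s) *\<^sub>R Y)
    \<in> neighborhood \<delta> x0 y0 X Y"
proof -
  have "\<bar>(1 + s) * a - a\<bar> \<le> \<delta> * a" "\<bar>(1 - s) * a - a\<bar> \<le> \<delta> * a" if "0 \<le> a" for a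
  proof -
    have "\<bar>s * a\<bar> \<le> \<delta> * a"
      using assms that by (simp add: abs_mult mult_right_mono)
    then show "\<bar>(1 + s) * a - a\<bar> \<le> \<delta> * a" "\<bar>(1 - s) * a - a\<bar> \<le> \<delta> * a"
      by (simp_all add: algebra_simps)
  qed
  then show ?thesis
    using nonneg by (simp add: neighborhood_def less_eq_vec_def)
qed

lemma neighborhood_nonpos_radius:
  assumes "\<delta> \<le> 0" and "(x0', y0', X', Y') \<in> neighborhood \<delta> x0 y0 X Y"
  shows "x0' = x0" "y0' = y0" "X' = X" "Y' = Y"
proof -
  have eq: "b = a" if "\<bar>b - a\<bar> \<le> \<delta> * a" "0 \<le> a" for a b
    using that mult_nonpos_nonneg[OF assms(1) that(2)] by linarith
  show "x0' = x0" "y0' = y0" "X' = X" "Y' = Y"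
    using assms(2) nonneg by (auto simp: neighborhood_def less_eq_vec_def vec_eq_iff intro!: eq)
qed

lemma all_efficient_iff_tilted:
  assumes "0 \<le> \<delta>"
  shows "(\<forall>(x0', y0', X', Y') \<in> neighborhood \<delta> x0 y0 X Y. efficient x0' y0' X' Y')
    \<longleftrightarrow> efficient_tilted \<delta> x0 y0 X Y"
proof
  assume "\<forall>(x0', y0', X', Y') \<in> neighborhood \<delta> x0 y0 X Y. efficient x0' y0' X' Y'"
  then show "efficient_tilted \<delta> x0 y0 X Y"
    using tilted_in_neighborhood[of \<delta> \<delta>] assms by (auto simp: efficient_tilted_def)
next
  assume "efficient_tilted \<delta> x0 y0 X Y"
  then show "\<forall>(x0', y0', X', Y') \<in> neighborhood \<delta> x0 y0 X Y. efficient x0' y0' X' Y'"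
    unfolding efficient_tilted_def by (auto elim!: efficient_mono dest: neighborhood_bounds)
qed

text \<open>For \<open>\<delta> > 1\<close> the most favorable inputs of \<open>DMU\<^sub>0\<close> and outputs of the other units have negative
  entries. The comparison with them still goes through, because monotonicity of efficiency rests on the
  signs of the weights.\<close>

lemma ex_efficient_iff_tilted:
  assumes "0 \<le> \<delta>"
  shows "(\<exists>(x0', y0', X', Y') \<in> neighborhood \<delta> x0 y0 X Y. efficient x0' y0' X' Y')
    \<longleftrightarrow> efficient_tilted (- \<delta>) x0 y0 X Y"
proof
  assume "\<exists>(x0', y0', X', Y') \<in> neighborhood \<delta> x0 y0 X Y. efficient x0' y0' X' Y'"
  then show "efficient_tilted (- \<delta>) x0 y0 X Y"
    unfolding efficient_tilted_def by (auto elim!: efficient_mono dest: neighborhood_bounds)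
next
  assume "efficient_tilted (- \<delta>) x0 y0 X Y"
  then show "\<exists>(x0', y0', X', Y') \<in> neighborhood \<delta> x0 y0 X Y. efficient x0' y0' X' Y'"
    using tilted_in_neighborhood[of "- \<delta>" \<delta>] assms
    by (auto simp: efficient_tilted_def intro!: bexI)
qed

lemma robustness_eq_Sup_tilted:
  "robustness x0 y0 X Y = Sup (ereal ` {s. efficient_tilted s x0 y0 X Y})"
proof (cases "efficient x0 y0 X Y")
  case True
  have "(\<forall>(x0', y0', X', Y') \<in> neighborhood \<delta> x0 y0 X Y. efficient x0' y0' X' Y')
    \<longleftrightarrow> efficient_tilted \<delta> x0 y0 X Y" for \<delta>
  proof (cases "0 \<le> \<delta>")
    case False
    then have "efficient_tilted \<delta> x0 y0 X Y"
      using True efficient_tilted_antimono[of 0 \<delta>] by (simp add: efficient_tilted_0)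
    moreover have "efficient x0' y0' X' Y'"
      if "(x0', y0', X', Y') \<in> neighborhood \<delta> x0 y0 X Y" for x0' y0' X' Y'
      using neighborhood_nonpos_radius[OF _ that] False True by simp
    ultimately show ?thesis by blast
  qed (rule all_efficient_iff_tilted)
  with True show ?thesis
    by (simp add: robustness_def)
next
  case False
  have "(\<exists>(x0', y0', X', Y') \<in> neighborhood \<delta> x0 y0 X Y. efficient x0' y0' X' Y')
    \<longleftrightarrow> efficient_tilted (- \<delta>) x0 y0 X Y" for \<delta>
  proof (cases "0 \<le> \<delta>")
    case neg: False
    then have "\<not> efficient_tilted (- \<delta>) x0 y0 X Y"
      using False efficient_tilted_antimono[of "- \<delta>" 0] by (auto simp: efficient_tilted_0)
    moreover have "\<not> efficient x0' y0' X' Y'"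
      if "(x0', y0', X', Y') \<in> neighborhood \<delta> x0 y0 X Y" for x0' y0' X' Y'
      using neighborhood_nonpos_radius[OF _ that] neg False by simp
    ultimately show ?thesis by blast
  qed (rule ex_efficient_iff_tilted)
  with False have "robustness x0 y0 X Y
    = - Inf (ereal ` {\<delta>. efficient_tilted (- \<delta>) x0 y0 X Y})"
    by (simp add: robustness_def)
  also have "ereal ` {\<delta>. efficient_tilted (- \<delta>) x0 y0 X Y}
    = uminus ` ereal ` {s. efficient_tilted s x0 y0 X Y}"
    by (force simp: image_iff intro: exI[of _ "- _"])
  also have "- Inf \<dots> = Sup (ereal ` {s. efficient_tilted s x0 y0 X Y})"
    by (simp only: ereal_Inf_uminus_image_eq ereal_uminus_uminus)
  finally show ?thesis .
qed

end

theorem theorem1: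
  fixes x0 :: "real^'n1" and y0 :: "real^'n2"
    and X :: "real^'n1^'m" and Y :: "real^'n2^'m"
  assumes "0 \<le> x0" and "0 \<le> y0" and "0 \<le> X" and "0 \<le> Y"
  shows "robustness x0 y0 X Y =
    Sup (ereal ` {\<delta>. \<exists>(u::real^'n2) (v::real^'n1). 0 \<le> u \<and> 0 \<le> v \<and>
      (1 - \<delta>) * (y0 \<bullet> u) \<ge> 1 \<and>
      (1 + \<delta>) * (x0 \<bullet> v) \<le> 1 \<and>
      (1 + \<delta>) *\<^sub>R (Y *v u) - (1 - \<delta>) *\<^sub>R (X *v v) \<le> 0})"
  using robustness_eq_Sup_tilted[OF assms] by (simp only: efficient_tilted_iff_feasible)

end
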